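(* Let $f:\mathbb{R}\to\mathbb{R}$ be a function that is vertically rigid for an uncountable set $C\subset(0,\infty)$ via translations. (i) If $f$ is Lebesgue measurable, then there exist $a,b,k\in\mathbb{R}$ such that $f(x)=a+be^{kx}$ for Lebesgue almost every $x\in\mathbb{R}$. (ii) If $f$ is Baire measurable, then there exist $a,b,k\in\mathbb{R}$ such that $f(x)=a+be^{kx}$ for all $x$ in a comeagre subset of $\mathbb{R}$.
   Context: For a function $h:\mathbb{R}\to\mathbb{R}$, $\mathrm{graph}(h)=\{(x,h(x)):x\in\mathbb{R}\}\subset\mathbb{R}^2$. For $C\subset(0,\infty)$, a function $f:\mathbb{R}\to\mathbb{R}$ is vertically rigid for $C$ via translations if for every $c\in C$ there exists a translation $\varphi$ of the plane $\mathbb{R}^2$ with $\varphi(\mathrm{graph}(cf))=\mathrm{graph}(f)$. A set is Baire measurable if it has the property of Baire (it differs from an open set by a meagre set); a function is Baire measurable if preimages of open sets are Baire measurable. A set is comeagre if its complement is meagre (first category). *)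

theory Defs
  imports "HOL-Analysis.Analysis"
begin

(* The graph of a total function as a subset of the product;
   the constant graph of theory Map concerns partial maps. *)
definition fun_graph :: "('a \<Rightarrow> 'b) \<Rightarrow> ('a \<times> 'b) set" where
  "fun_graph h = {(x, h x) | x. True}"

definition plane_translation :: "(real \<times> real \<Rightarrow> real \<times> real) \<Rightarrow> bool" where
  "plane_translation \<phi> \<longleftrightarrow> (\<exists>v. \<forall>p. \<phi> p = p + v)"

definition vertically_rigid_via_translations :: "(real \<Rightarrow> real) \<Rightarrow> real set \<Rightarrow> bool" where
  "vertically_rigid_via_translations f C \<longleftrightarrow>
     (\<forall>c\<in>C. \<exists>\<phi>. plane_translation \<phi> \<and> \<phi> ` fun_graph (\<lambda>x. c * f x) = fun_graph f)"

definition nowhere_dense :: "'a::topological_space set \<Rightarrow> bool" where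
  "nowhere_dense S \<longleftrightarrow> interior (closure S) = {}"

definition meagre :: "'a::topological_space set \<Rightarrow> bool" where
  "meagre S \<longleftrightarrow> (\<exists>N :: nat \<Rightarrow> 'a set. (\<forall>n. nowhere_dense (N n)) \<and> S = (\<Union>n. N n))"

definition comeagre :: "'a::topological_space set \<Rightarrow> bool" where
  "comeagre S \<longleftrightarrow> meagre (- S)"

definition has_Baire_property :: "'a::topological_space set \<Rightarrow> bool" where
  "has_Baire_property S \<longleftrightarrow> (\<exists>U. open U \<and> meagre (sym_diff S U))"

definition Baire_measurable :: "('a::topological_space \<Rightarrow> 'b::topological_space) \<Rightarrow> bool" where
  "Baire_measurable f \<longleftrightarrow> (\<forall>V. open V \<longrightarrow> has_Baire_property (f -` V))"

end

theory Submission
  imports Defs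
begin

text \<open>Rigidity yields relations \<open>f (x + u) = c * f x + v\<close> with uncountably many shifts \<open>u\<close>, hence with
  arbitrarily small nonzero differences of shifts. Subtracting the common fixed point of the affine
  maps from \<open>f\<close> gives \<open>F\<close> with \<open>F (x + u) = exp l * F x\<close> for \<open>u\<close> in a dense group. By a Steinhaus
  argument \<open>l\<close> is bounded for small \<open>u\<close>, so \<open>l = k * u\<close>; then \<open>F x * exp (- k * x)\<close> is invariant under
  a dense group of translations, hence almost constant. Only the Steinhaus property is needed, so
  Lebesgue measure and Baire category are treated alike, the latter through the measure that is
  \<open>0\<close> on meagre sets and \<open>\<infinity>\<close> on all other sets with the Baire property.\<close>

section \<open>Measures with the Steinhaus property\<close>

text \<open>The Steinhaus property is stated for two sets because it is applied both to
  \<open>A\<close> with itself and to \<open>A\<close> with its complement. For distinct sets the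
  open set of differences \<open>b - a\<close> need not contain 0, so only its nonemptiness is
  demanded.\<close>

locale steinhaus_measure =
  fixes M :: "real measure"
  assumes borel_sets: "sets borel \<subseteq> sets M"
    and steinhaus: "\<lbrakk>A \<in> sets M; A \<notin> null_sets M; B \<in> sets M; B \<notin> null_sets M\<rbrakk>
      \<Longrightarrow> \<exists>U. open U \<and> U \<noteq> {} \<and> (\<forall>u\<in>U. \<exists>a\<in>A. a + u \<in> B)"
begin

lemma space_eq: "space M = UNIV"
  using borel_sets sets.sets_into_space[of UNIV M]
  by (metis sets.top space_borel subsetD top.extremum_uniqueI)

lemma borel_measurable_if_borel: "g \<in> borel_measurable borel \<Longrightarrow> g \<in> borel_measurable M"
  using borel_sets space_eq by (auto simp: measurable_def)

text \<open>A zero-one law: if neither \<open>A\<close> nor its complement were null, the open set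
  of differences from \<open>A\<close> to \<open>- A\<close> would meet the dense set
  \<open>H\<close>, and some \<open>u\<close> in \<open>H\<close> would move a point of
  \<open>A\<close> out of \<open>A\<close>.\<close>

lemma invariant_null_or_conull:
  assumes A: "A \<in> sets M" and H: "closure H = UNIV"
    and inv: "\<And>x u. x \<in> A \<Longrightarrow> u \<in> H \<Longrightarrow> x + u \<in> A"
  shows "(AE x in M. x \<notin> A) \<or> (AE x in M. x \<in> A)"
proof (rule ccontr)
  assume neg: "\<not> ?thesis"
  have "- A \<in> sets M"
    using sets.compl_sets[OF A] by (simp add: space_eq Compl_eq_Diff_UNIV)
  moreover have "A \<notin> null_sets M" "- A \<notin> null_sets M"
    using neg AE_not_in[of A M] AE_not_in[of "- A" M] by auto
  ultimately obtain U where U: "open U" "U \<noteq> {}" "\<forall>u\<in>U. \<exists>a\<in>A. a + u \<in> - A"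
    using steinhaus[OF A] by blast
  have "U \<inter> H \<noteq> {}"
    using open_Int_closure_eq_empty[OF U(1), of H] U(2) H by auto
  then show False
    using U(3) inv by blast
qed

text \<open>Each sublevel set of \<open>h\<close> inherits the invariance and is therefore null or
  conull. The constant is the threshold at which the sublevel sets switch from null to
  conull.\<close>

lemma AE_const_if_invariant:
  fixes h :: "real \<Rightarrow> real"
  assumes h[measurable]: "h \<in> borel_measurable M" and H: "closure H = UNIV"
    and inv: "\<And>x u. u \<in> H \<Longrightarrow> h (x + u) = h x"
  shows "\<exists>c. AE x in M. h x = c"
proof (cases "AE x in M. False")
  case True
  then show ?thesis by (auto elim: eventually_mono)
next
  case nontriv: False
  have dich: "(AE x in M. \<not> h x < t) \<or> (AE x in M. h x < t)" for t
    using invariant_null_or_conull[OF _ H, of "{x. h x < t}"] inv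
    using h space_eq by (auto simp: borel_measurable_iff_less)
  \<comment> \<open>\<open>T\<close> is an up-set of reals. If it were empty or unbounded below,
    \<open>h\<close> would almost everywhere exceed every natural number or lie below every negative
    one, which is absurd unless \<open>M\<close> is the zero measure.\<close>
  define T where "T = {t. AE x in M. h x < t}"
  have "\<exists>n::nat. real n \<in> T"
  proof (rule ccontr)
    assume "\<not> ?thesis"
    then have "\<forall>n::nat. AE x in M. \<not> h x < real n"
      using dich by (auto simp: T_def)
    then have "AE x in M. \<forall>n::nat. \<not> h x < real n"
      by (simp add: AE_all_countable)
    then have "AE x in M. False"
      by eventually_elim (use reals_Archimedean2 in blast)
    with nontriv show False ..
  qed
  then have ne: "T \<noteq> {}" by auto
  have "\<exists>n::nat. - real n \<notin> T"
  proof (rule ccontr)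
    assume "\<not> ?thesis"
    then have "AE x in M. \<forall>n::nat. h x < - real n"
      by (simp add: AE_all_countable T_def)
    then have "AE x in M. False"
    proof eventually_elim
      case (elim x)
      obtain n :: nat where "- h x < real n" using reals_Archimedean2 by blast
      with elim[rule_format, of n] show ?case by simp
    qed
    with nontriv show False ..
  qed
  then obtain n :: nat where n: "- real n \<notin> T" ..
  have up: "t \<in> T" if "s \<in> T" "s \<le> t" for s t
    using that by (auto simp: T_def elim!: eventually_mono)
  have bdd: "bdd_below T"
    using n up by (intro bdd_belowI[of _ "- real n"]) (meson linear)
  define c where "c = Inf T"
  \<comment> \<open>Approaching \<open>c\<close> through countably many thresholds allows the
    exceptional null sets to be united.\<close>
  have "AE x in M. h x < c + 1 / Suc m" for m
  proof -
    obtain s where "s \<in> T" "s < c + 1 / Suc m"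
      using cInf_less_iff[OF ne bdd, of "c + 1 / Suc m"] by (auto simp: c_def)
    then show ?thesis using up[of s "c + 1 / Suc m"] by (simp add: T_def)
  qed
  moreover have "AE x in M. \<not> h x < c - 1 / Suc m" for m
  proof -
    have "c - 1 / Suc m \<notin> T"
      using cInf_lower[OF _ bdd, of "c - 1 / Suc m"] by (auto simp: c_def)
    then show ?thesis using dich by (auto simp: T_def)
  qed
  ultimately have "AE x in M. \<forall>m. h x < c + 1 / Suc m \<and> \<not> h x < c - 1 / Suc m"
    by (simp add: AE_all_countable)
  then have "AE x in M. h x = c"
  proof eventually_elim
    case (elim x)
    show ?case
    proof (rule ccontr)
      assume "h x \<noteq> c"
      then obtain m where "1 / Suc m < \<bar>h x - c\<bar>"
        using nat_approx_posE[of "\<bar>h x - c\<bar>"] by auto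
      with elim[rule_format, of m] show False by linarith
    qed
  qed
  then show ?thesis ..
qed

end

section \<open>Exponential scaling\<close>

text \<open>A relation and not a function of \<open>u\<close>, since \<open>l\<close> is not
  determined when \<open>F\<close> vanishes identically. Logarithms turn composition of shifts into
  addition, so this is a subgroup of the plane, as the next lemmas show.\<close>

definition log_multipliers :: "(real \<Rightarrow> real) \<Rightarrow> (real \<times> real) set" where
  "log_multipliers F = {(u, l). \<forall>x. F (x + u) = exp l * F x}"

lemma log_multipliers_add:
  assumes "(u, l) \<in> log_multipliers F" "(u', l') \<in> log_multipliers F"
  shows "(u + u', l + l') \<in> log_multipliers F"
proof -
  have "F (x + (u + u')) = exp (l + l') * F x" for x
    using assms by (simp add: log_multipliers_def exp_add mult_ac flip: add.assoc)
  then show ?thesis by (simp add: log_multipliers_def)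
qed

lemma log_multipliers_minus:
  assumes "(u, l) \<in> log_multipliers F"
  shows "(- u, - l) \<in> log_multipliers F"
proof -
  have "F (x + - u) = exp (- l) * F x" for x
  proof -
    have "F x = exp l * F (x - u)"
      using assms[unfolded log_multipliers_def, simplified, rule_format, of "x - u"] by simp
    then show ?thesis by (simp add: exp_minus)
  qed
  then show ?thesis by (simp add: log_multipliers_def)
qed

lemma log_multipliers_of_nat_mult:
  assumes "(u, l) \<in> log_multipliers F"
  shows "(of_nat n * u, of_nat n * l) \<in> log_multipliers F"
proof (induction n)
  case 0
  then show ?case by (simp add: log_multipliers_def)
next
  case (Suc n)
  then show ?case using log_multipliers_add[OF assms Suc] by (simp add: algebra_simps)
qed

lemma log_multipliers_of_int_mult:
  assumes "(u, l) \<in> log_multipliers F"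
  shows "(of_int m * u, of_int m * l) \<in> log_multipliers F"
proof (cases m rule: int_cases2)
  case (nonneg n)
  then show ?thesis using log_multipliers_of_nat_mult[OF assms] by simp
next
  case (nonpos n)
  then show ?thesis
    using log_multipliers_minus[OF log_multipliers_of_nat_mult[OF assms, of n]] by simp
qed

text \<open>The integer multiples of one nonzero shift shorter than \<open>e\<close> form a grid of
  mesh less than \<open>e\<close>.\<close>

lemma closure_Domain_log_multipliers:
  assumes small: "\<And>e. e > 0 \<Longrightarrow> \<exists>(u, l)\<in>log_multipliers F. u \<noteq> 0 \<and> \<bar>u\<bar> < e"
  shows "closure (Domain (log_multipliers F)) = UNIV"
proof -
  have "\<exists>y\<in>Domain (log_multipliers F). dist y x < e" if e: "e > 0" for x e
  proof -
    obtain u l where ul: "(u, l) \<in> log_multipliers F" "u \<noteq> 0" "\<bar>u\<bar> < e"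
      using small[OF e] by auto
    have "x - of_int \<lfloor>x / u\<rfloor> * u = frac (x / u) * u"
      using ul(2) by (simp add: frac_def field_simps)
    then have "\<bar>x - of_int \<lfloor>x / u\<rfloor> * u\<bar> = frac (x / u) * \<bar>u\<bar>"
      by (simp add: abs_mult)
    also have "\<dots> \<le> 1 * \<bar>u\<bar>"
      by (intro mult_right_mono) (auto simp: frac_lt_1 less_imp_le)
    finally have "dist (of_int \<lfloor>x / u\<rfloor> * u) x < e"
      using ul(3) by (simp add: dist_real_def abs_minus_commute)
    then show ?thesis
      using log_multipliers_of_int_mult[OF ul(1)] by blast
  qed
  then show ?thesis by (auto simp: closure_approachable)
qed

text \<open>Subtracting a suitable integer multiple of \<open>(w, l0)\<close> from \<open>n\<close>
  times \<open>(u, l)\<close> brings the shift into the interval from 0 to \<open>w\<close>, where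
  the bound applies. The logarithm left over is \<open>n * (l - l0 / w * u)\<close> up to an error
  of at most \<open>\<bar>l0\<bar>\<close>; being bounded in \<open>n\<close>, it forces the bracket
  to vanish.\<close>

lemma log_multipliers_linear:
  assumes bound: "\<And>u l. (u, l) \<in> log_multipliers F \<Longrightarrow> \<bar>u\<bar> < d \<Longrightarrow> \<bar>l\<bar> \<le> B"
    and w: "(w, l0) \<in> log_multipliers F" "0 < w" "w < d"
    and ul: "(u, l) \<in> log_multipliers F"
  shows "l = l0 / w * u"
proof (rule ccontr)
  assume ne: "l \<noteq> l0 / w * u"
  define D where "D = \<bar>l - l0 / w * u\<bar>"
  have "D > 0" using ne by (simp add: D_def)
  have "real n * D \<le> B + \<bar>l0\<bar>" for n :: nat
  proof -
    define m where "m = \<lfloor>real n * u / w\<rfloor>"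
    define r where "r = frac (real n * u / w)"
    have m: "of_int m = real n * u / w - r"
      by (simp add: m_def r_def frac_def)
    have r: "0 \<le> r" "r < 1" by (simp_all add: r_def frac_lt_1)
    have "(real n * u + of_int (- m) * w, real n * l + of_int (- m) * l0) \<in> log_multipliers F"
      by (intro log_multipliers_add log_multipliers_of_nat_mult log_multipliers_of_int_mult ul w)
    moreover have "real n * u + of_int (- m) * w = r * w"
      using w(2) by (simp add: m algebra_simps)
    moreover have "real n * l + of_int (- m) * l0 = real n * (l - l0 / w * u) + r * l0"
      using w(2) by (simp add: m algebra_simps)
    ultimately have "(r * w, real n * (l - l0 / w * u) + r * l0) \<in> log_multipliers F"
      by simp
    moreover have "\<bar>r * w\<bar> < d"
      using mult_strict_right_mono[OF r(2) w(2)] mult_nonneg_nonneg[OF r(1), of w] w(2,3) by linarith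
    ultimately have "\<bar>real n * (l - l0 / w * u) + r * l0\<bar> \<le> B"
      by (rule bound)
    moreover have "\<bar>r * l0\<bar> \<le> \<bar>l0\<bar>"
      using r by (simp add: abs_mult mult_left_le_one_le)
    moreover have "real n * D = \<bar>real n * (l - l0 / w * u)\<bar>"
      by (simp add: D_def abs_mult)
    ultimately show ?thesis by linarith
  qed
  moreover obtain n :: nat where "real n * D > B + \<bar>l0\<bar>"
    using ex_less_of_nat_mult[OF \<open>D > 0\<close>] by blast
  ultimately show False by (meson not_less)
qed

section \<open>Local boundedness of the multipliers and the exponential form\<close>

context steinhaus_measure
begin

text \<open>The sets \<open>A n\<close>, on which \<open>\<bar>F\<bar>\<close> is bounded above and
  away from 0, exhaust the points where \<open>F\<close> is nonzero, so one of them is not null. By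
  Steinhaus every shift in some open \<open>J\<close> moves a point of it to another such point,
  which limits the ratio of the two values of \<open>F\<close>.\<close>

lemma log_multipliers_locally_bounded:
  assumes F[measurable]: "F \<in> borel_measurable M"
    and nz: "\<not> (AE x in M. F x = 0)"
    and dense: "closure (Domain (log_multipliers F)) = UNIV"
  shows "\<exists>d B. d > 0 \<and> (\<forall>(u, l)\<in>log_multipliers F. \<bar>u\<bar> < d \<longrightarrow> \<bar>l\<bar> \<le> B)"
proof -
  define A where "A n = {x. 1 / Suc n \<le> \<bar>F x\<bar> \<and> \<bar>F x\<bar> \<le> Suc n}" for n
  have "{x \<in> space M. 1 / Suc n \<le> \<bar>F x\<bar> \<and> \<bar>F x\<bar> \<le> Suc n} \<in> sets M" for n
    by measurable
  then have A: "A n \<in> sets M" for n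
    by (simp add: A_def space_eq)
  have "\<exists>n. A n \<notin> null_sets M"
  proof (rule ccontr)
    assume "\<not> ?thesis"
    then have "AE x in M. \<forall>n. x \<notin> A n"
      by (simp add: AE_all_countable AE_not_in)
    then have "AE x in M. F x = 0"
    proof eventually_elim
      case (elim x)
      show ?case
      proof (rule ccontr)
        assume "F x \<noteq> 0"
        then obtain p where p: "1 / Suc p < \<bar>F x\<bar>"
          using nat_approx_posE[of "\<bar>F x\<bar>"] by auto
        obtain q :: nat where q: "\<bar>F x\<bar> < real q" using reals_Archimedean2 by blast
        have "1 / Suc (max p q) \<le> 1 / Suc p" by (simp add: frac_le)
        then have "x \<in> A (max p q)" using p q by (simp add: A_def)
        with elim show False by blast
      qed
    qed
    with nz show False ..
  qed
  then obtain n where n: "A n \<notin> null_sets M" ..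
  obtain J where J: "open J" "J \<noteq> {}" "\<forall>u\<in>J. \<exists>a\<in>A n. a + u \<in> A n"
    using steinhaus[OF A n A n] by blast
  define N where "N = real (Suc n)"
  have N: "N > 0" by (simp add: N_def)
  \<comment> \<open>The ratio of two numbers between \<open>1 / N\<close> and \<open>N\<close> lies
    between \<open>1 / (N * N)\<close> and \<open>N * N\<close>.\<close>
  define B where "B = ln (N * N)"
  have JB: "\<bar>l\<bar> \<le> B" if "(u, l) \<in> log_multipliers F" and u: "u \<in> J" for u l
  proof -
    obtain a where a: "a \<in> A n" "a + u \<in> A n" using J(3) u by blast
    have e: "\<bar>F (a + u)\<bar> = exp l * \<bar>F a\<bar>"
      using that by (simp add: log_multipliers_def abs_mult)
    have b: "1 / N \<le> \<bar>F a\<bar>" "\<bar>F a\<bar> \<le> N" "1 / N \<le> exp l * \<bar>F a\<bar>" "exp l * \<bar>F a\<bar> \<le> N"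
      using a unfolding e[symmetric] by (simp_all add: A_def N_def)
    have "exp l * (1 / N) \<le> exp l * \<bar>F a\<bar>" using b by (intro mult_left_mono) auto
    then have "exp l * (1 / N) \<le> N" using b by linarith
    then have 1: "exp l \<le> N * N" using N by (simp add: field_simps)
    have "exp l * \<bar>F a\<bar> \<le> exp l * N" using b by (intro mult_left_mono) auto
    then have "1 / N \<le> exp l * N" using b by linarith
    then have 2: "exp (- l) \<le> N * N" using N by (simp add: field_simps exp_minus)
    have "l \<le> B" "- l \<le> B"
      using 1 2 N by (simp_all add: B_def ln_ge_iff)
    then show ?thesis by linarith
  qed
  have "J \<inter> Domain (log_multipliers F) \<noteq> {}"
    using open_Int_closure_eq_empty[OF J(1), of "Domain (log_multipliers F)"] J(2) dense by auto
  \<comment> \<open>\<open>J\<close> need not contain 0. A shift \<open>u0\<close> in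
    \<open>J\<close> serves as base point: \<open>u\<close> near 0 is the difference of
    \<open>u0 + u\<close> and \<open>u0\<close>, which costs a factor 2 in the bound.\<close>
  then obtain u0 l0 where u0: "u0 \<in> J" "(u0, l0) \<in> log_multipliers F" by blast
  obtain d where d: "d > 0" "ball u0 d \<subseteq> J" using J(1) u0(1) openE by blast
  have "\<bar>l\<bar> \<le> 2 * B" if "(u, l) \<in> log_multipliers F" "\<bar>u\<bar> < d" for u l
  proof -
    have "u0 + u \<in> J" using d(2) that(2) by (auto simp: dist_real_def)
    then have "\<bar>l0 + l\<bar> \<le> B" using JB log_multipliers_add[OF u0(2) that(1)] by blast
    moreover have "\<bar>l0\<bar> \<le> B" using JB u0 by blast
    ultimately show ?thesis by linarith
  qed
  then show ?thesis using d(1) by blast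
qed

lemma AE_exponential:
  assumes F[measurable]: "F \<in> borel_measurable M"
    and small: "\<And>e. e > 0 \<Longrightarrow> \<exists>(u, l)\<in>log_multipliers F. u \<noteq> 0 \<and> \<bar>u\<bar> < e"
  shows "\<exists>b k. AE x in M. F x = b * exp (k * x)"
proof (cases "AE x in M. F x = 0")
  case True
  then have "AE x in M. F x = 0 * exp (0 * x)" by simp
  then show ?thesis by blast
next
  case False
  note dense = closure_Domain_log_multipliers[OF small]
  obtain d B where d: "d > 0"
    and bound: "\<And>u l. (u, l) \<in> log_multipliers F \<Longrightarrow> \<bar>u\<bar> < d \<Longrightarrow> \<bar>l\<bar> \<le> B"
    using log_multipliers_locally_bounded[OF F False dense] by blast
  obtain w l0 where w: "(w, l0) \<in> log_multipliers F" "0 < w" "w < d"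
  proof -
    obtain u l where ul: "(u, l) \<in> log_multipliers F" "u \<noteq> 0" "\<bar>u\<bar> < d"
      using small[OF d] by auto
    show thesis
      using that[of u l] that[of "- u" "- l"] log_multipliers_minus[OF ul(1)] ul
      by (cases "u > 0") auto
  qed
  \<comment> \<open>The exponent is read off from the single short shift \<open>w\<close>; linearity
    carries it over to all shifts.\<close>
  define k where "k = l0 / w"
  have lin: "l = k * u" if "(u, l) \<in> log_multipliers F" for u l
    using log_multipliers_linear[OF bound w that] by (simp add: k_def)
  define h where "h x = F x * exp (- (k * x))" for x
  have [measurable]: "(\<lambda>x. exp (- (k * x))) \<in> borel_measurable M"
    by (rule borel_measurable_if_borel) measurable
  have "h \<in> borel_measurable M" unfolding h_def by measurable
  moreover have "h (x + u) = h x" if u: "u \<in> Domain (log_multipliers F)" for x u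
  proof -
    obtain l where l: "(u, l) \<in> log_multipliers F" using u by blast
    have "F (x + u) = exp (k * u) * F x" using l lin[OF l] by (simp add: log_multipliers_def)
    then show ?thesis by (simp add: h_def distrib_left exp_add exp_diff exp_minus field_simps)
  qed
  ultimately obtain b where "AE x in M. h x = b"
    using AE_const_if_invariant[OF _ dense] by blast
  then have "AE x in M. F x = b * exp (k * x)"
    by eventually_elim (auto simp: h_def exp_minus)
  then show ?thesis by blast
qed

end

section \<open>Vertically rigid functions\<close>

lemma vertically_rigid_via_translationsD:
  assumes "vertically_rigid_via_translations f C" "c \<in> C"
  shows "\<exists>u v. \<forall>x. f (x + u) = c * f x + v"
proof -
  obtain \<phi> where \<phi>: "plane_translation \<phi>" "\<phi> ` fun_graph (\<lambda>x. c * f x) = fun_graph f"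
    using assms by (auto simp: vertically_rigid_via_translations_def)
  obtain u v where uv: "\<And>p. \<phi> p = p + (u, v)"
    using \<phi>(1) by (auto simp: plane_translation_def)
  have "f (x + u) = c * f x + v" for x
  proof -
    have "\<phi> (x, c * f x) \<in> fun_graph f"
      using \<phi>(2) by (auto simp: fun_graph_def)
    then show ?thesis by (simp add: uv fun_graph_def)
  qed
  then show ?thesis by blast
qed

text \<open>Pigeonhole: the line splits into countably many cells of length \<open>e\<close>, so two
  elements of \<open>C\<close> fall into the same cell.\<close>

lemma uncountable_image_close_points:
  fixes u :: "'a \<Rightarrow> real"
  assumes "uncountable C" "e > 0"
  shows "\<exists>c\<in>C. \<exists>d\<in>C. c \<noteq> d \<and> \<bar>u c - u d\<bar> < e"
proof -
  have "\<not> inj_on (\<lambda>c. \<lfloor>u c / e\<rfloor>) C"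
    using assms(1) countable_image_inj_on[of "\<lambda>c. \<lfloor>u c / e\<rfloor>" C] by blast
  then obtain c d where cd: "c \<in> C" "d \<in> C" "c \<noteq> d" "\<lfloor>u c / e\<rfloor> = \<lfloor>u d / e\<rfloor>"
    by (auto simp: inj_on_def)
  have "\<bar>u c / e - u d / e\<bar> < 1"
    using cd(4) by linarith
  then have "\<bar>u c - u d\<bar> < e"
    using assms(2) by (simp add: abs_divide flip: diff_divide_distrib)
  with cd show ?thesis by blast
qed

text \<open>The transformations are determined by their horizontal parts, so they commute, and commuting
  affine maps \<open>y \<mapsto> c * y + v\<close> share the fixed point \<open>a\<close> of any one of them with \<open>c \<noteq> 1\<close>.\<close>

lemma (in steinhaus_measure) AE_exponential_if_rigid:
  assumes [measurable]: "f \<in> borel_measurable M"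
    and pos: "C \<subseteq> {0<..}" and unc: "uncountable C"
    and rigid: "vertically_rigid_via_translations f C"
  shows "\<exists>a b k. AE x in M. f x = a + b * exp (k * x)"
proof (cases "\<exists>a. \<forall>x. f x = a")
  case True
  then obtain a where "\<And>x. f x = a" by blast
  then have "AE x in M. f x = a + 0 * exp (0 * x)" by simp
  then show ?thesis by blast
next
  case nonconst: False
  obtain u v where uv: "\<And>c x. c \<in> C \<Longrightarrow> f (x + u c) = c * f x + v c"
    using vertically_rigid_via_translationsD[OF rigid] by metis
  have inj: "c = d" if "c \<in> C" "d \<in> C" "u c = u d" for c d
  proof (rule ccontr)
    assume "c \<noteq> d"
    \<comment> \<open>Two different factors with the same shift give two equations whose difference
      determines \<open>f x\<close> independently of \<open>x\<close>.\<close>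
    have "f x = (v d - v c) / (c - d)" for x
      using uv[OF that(1), of x] uv[OF that(2), of x] that(3) \<open>c \<noteq> d\<close> by (simp add: field_simps)
    with nonconst show False by blast
  qed
  have "C - {1} \<noteq> {}"
    using unc by (metis countable_empty uncountable_minus_countable countable_finite finite.simps)
  then obtain c0 where c0: "c0 \<in> C" "c0 \<noteq> 1" by blast
  define a where "a = v c0 / (1 - c0)"
  have va: "v c = a * (1 - c)" if c: "c \<in> C" for c
  proof -
    have "f (0 + u c + u c0) = f (0 + u c0 + u c)" by (simp add: add.commute)
    then have "c0 * (c * f 0 + v c) + v c0 = c * (c0 * f 0 + v c0) + v c"
      using uv c c0(1) by metis
    then have "v c * (1 - c0) = v c0 * (1 - c)" by (simp add: algebra_simps)
    then show ?thesis using c0(2) by (simp add: a_def field_simps)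
  qed
  define F where "F x = f x - a" for x
  have Fu: "F (x + u c) = c * F x" if "c \<in> C" for x c
    using uv[OF that] va[OF that] by (simp add: F_def algebra_simps)
  have "\<exists>(w, l)\<in>log_multipliers F. w \<noteq> 0 \<and> \<bar>w\<bar> < e" if e: "e > 0" for e
  proof -
    obtain c d where cd: "c \<in> C" "d \<in> C" "c \<noteq> d" "\<bar>u c - u d\<bar> < e"
      using uncountable_image_close_points[OF unc e] by blast
    have p: "c > 0" "d > 0" using cd pos by auto
    \<comment> \<open>Shifting by \<open>u c\<close> scales by \<open>c\<close>, and undoing the
      shift by \<open>u d\<close> divides by \<open>d\<close>; hence the second equation is taken at
      \<open>x + (u c - u d)\<close>.\<close>
    have "F (x + (u c - u d)) = exp (ln (c / d)) * F x" for x
      using Fu[OF cd(1), of x] Fu[OF cd(2), of "x + (u c - u d)"] p by (simp add: field_simps)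
    then have "(u c - u d, ln (c / d)) \<in> log_multipliers F"
      by (simp add: log_multipliers_def)
    moreover have "u c - u d \<noteq> 0" using inj cd by auto
    ultimately show ?thesis using cd(4) by blast
  qed
  moreover have "F \<in> borel_measurable M" unfolding F_def by measurable
  ultimately obtain b k where "AE x in M. F x = b * exp (k * x)"
    using AE_exponential by blast
  then have "AE x in M. f x = a + b * exp (k * x)"
    by eventually_elim (simp add: F_def algebra_simps)
  then show ?thesis by blast
qed


section \<open>Lebesgue measure\<close>

text \<open>Cutting with a large ball gives a bounded nonnull part \<open>T\<close> of finite
  measure. A closed subset approximating \<open>T\<close> with error below the whole measure of
  \<open>T\<close> cannot be null.\<close>

lemma nonnull_lebesgue_inner_compact:
  fixes S :: "'a::euclidean_space set"
  assumes S: "S \<in> sets lebesgue" "S \<notin> null_sets lebesgue"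
  shows "\<exists>K. compact K \<and> K \<subseteq> S \<and> emeasure lborel K > 0"
proof -
  have "\<exists>n::nat. S \<inter> cball 0 n \<notin> null_sets lebesgue"
  proof (rule ccontr)
    assume "\<not> ?thesis"
    then have "(\<Union>n::nat. S \<inter> cball 0 n) \<in> null_sets lebesgue" by (intro null_sets_UN) auto
    moreover have "(\<Union>n::nat. S \<inter> cball 0 n) = S" by (auto intro: real_arch_simple)
    ultimately show False using S(2) by simp
  qed
  then obtain n :: nat where n: "S \<inter> cball 0 n \<notin> null_sets lebesgue" ..
  define T where "T = S \<inter> cball 0 (real n)"
  have T: "T \<in> sets lebesgue" "bounded T"
    using S(1) by (auto simp: T_def bounded_Int)
  then have fm: "T \<in> lmeasurable" by (simp add: bounded_set_imp_lmeasurable)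
  have pos: "measure lebesgue T > 0"
    using n T(1) fm
    by (auto simp: T_def[symmetric] null_sets_def emeasure_eq_measure2 zero_less_measure_iff)
  obtain K where K: "closed K" "K \<subseteq> T" "T - K \<in> lmeasurable"
      "emeasure lebesgue (T - K) < ennreal (measure lebesgue T)"
    using sets_lebesgue_inner_closed[OF T(1) pos] by metis
  have "compact K" using K T(2) bounded_subset compact_eq_bounded_closed by blast
  moreover have "emeasure lborel K \<noteq> 0"
  proof
    assume "emeasure lborel K = 0"
    then have "K \<in> null_sets lebesgue" using K(1) by (auto simp: null_sets_def)
    then have "emeasure lebesgue (T - K) = emeasure lebesgue T"
      using T(1) by (simp add: emeasure_Diff_null_set)
    with K(4) fm show False by (simp add: emeasure_eq_measure2)
  qed
  ultimately show ?thesis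
    using K(2) by (intro exI[of _ K]) (auto simp: T_def zero_less_iff_neq_zero)
qed

lemma emeasure_lborel_vimage_plus:
  fixes t :: "'a::euclidean_space"
  assumes "S \<in> sets borel"
  shows "emeasure lborel ((\<lambda>x. t + x) -` S) = emeasure lborel S"
  using emeasure_distr[of "(+) t" lborel borel S] assms by (simp add: lborel_distr_plus)

text \<open>By Fubini, the integral over \<open>u\<close> of the measure of \<open>L \<inter> (K + u)\<close> is the product of the measures
  of \<open>K\<close> and \<open>L\<close>.\<close>

lemma lborel_translate_meets_in_positive_measure:
  fixes K L :: "real set"
  assumes [measurable]: "K \<in> sets borel" "L \<in> sets borel"
    and pos: "emeasure lborel K > 0" "emeasure lborel L > 0"
  shows "\<exists>u. emeasure lborel {x \<in> L. x - u \<in> K} > 0"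
proof (rule ccontr)
  assume "\<not> ?thesis"
  then have 0: "emeasure lborel {x \<in> L. x - u \<in> K} = 0" for u
    by (simp add: zero_less_iff_neq_zero)
  have "emeasure lborel L * emeasure lborel K
      = (\<integral>\<^sup>+x. indicator L x * emeasure lborel K \<partial>lborel)"
    by (simp add: nn_integral_multc)
  also have "\<dots> = (\<integral>\<^sup>+x. (\<integral>\<^sup>+u. indicator L x * indicator K (x - u) \<partial>lborel) \<partial>lborel)"
  proof (rule nn_integral_cong)
    fix x :: real
    \<comment> \<open>For fixed \<open>x\<close>, the reflection taking \<open>u\<close> to
      \<open>x - u\<close> preserves Lebesgue measure.\<close>
    have "emeasure lborel K = (\<integral>\<^sup>+u. indicator K (x - u) \<partial>lborel)"
      using nn_integral_real_affine[of "indicator K" "-1" x] by simp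
    then show "indicator L x * emeasure lborel K
        = (\<integral>\<^sup>+u. indicator L x * indicator K (x - u) \<partial>lborel)"
      by (simp add: nn_integral_cmult)
  qed
  also have "\<dots> = (\<integral>\<^sup>+u. (\<integral>\<^sup>+x. indicator L x * indicator K (x - u) \<partial>lborel) \<partial>lborel)"
    by (rule lborel_pair.Fubini') measurable
  also have "\<dots> = (\<integral>\<^sup>+u. emeasure lborel {x \<in> L. x - u \<in> K} \<partial>lborel)"
  proof (rule nn_integral_cong)
    fix u :: real
    have "(\<integral>\<^sup>+x. indicator L x * indicator K (x - u) \<partial>lborel)
        = (\<integral>\<^sup>+x. indicator {x \<in> L. x - u \<in> K} x \<partial>lborel)"
      by (intro nn_integral_cong) (auto simp: indicator_def)
    also have "\<dots> = emeasure lborel {x \<in> L. x - u \<in> K}"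
      by (intro nn_integral_indicator) measurable
    finally show "(\<integral>\<^sup>+x. indicator L x * indicator K (x - u) \<partial>lborel)
        = emeasure lborel {x \<in> L. x - u \<in> K}" .
  qed
  also have "\<dots> = 0" by (simp add: 0)
  finally show False using pos by auto
qed

text \<open>Some translate of the compact set \<open>K\<close> meets \<open>L\<close> in a set of
  measure \<open>e > 0\<close>, and an open \<open>T\<close> around \<open>K\<close> exceeds
  \<open>K\<close> by less than \<open>e\<close>. If no point of \<open>A\<close> reached
  \<open>B\<close> under a shift \<open>u + h\<close> with small \<open>h\<close>, moving that
  intersection back by \<open>u + h\<close> would place it inside \<open>T - K\<close>, which is too
  small.\<close>

theorem steinhaus_measure_lebesgue: "steinhaus_measure lebesgue"
proof
  show "sets borel \<subseteq> sets (lebesgue :: real measure)" by auto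
next
  fix A B :: "real set"
  assume "A \<in> sets lebesgue" "A \<notin> null_sets lebesgue"
  then obtain K where K: "compact K" "K \<subseteq> A" "emeasure lborel K > 0"
    using nonnull_lebesgue_inner_compact by blast
  assume "B \<in> sets lebesgue" "B \<notin> null_sets lebesgue"
  then obtain L where L: "compact L" "L \<subseteq> B" "emeasure lborel L > 0"
    using nonnull_lebesgue_inner_compact by blast
  have [measurable]: "K \<in> sets borel" "L \<in> sets borel"
    using K L by (auto simp: compact_imp_closed)
  obtain u where u: "emeasure lborel {x \<in> L. x - u \<in> K} > 0"
    using lborel_translate_meets_in_positive_measure[OF _ _ K(3) L(3)] by auto
  \<comment> \<open>Compactness of \<open>L\<close> makes the measure of the intersection finite, so
    it can serve as a real error bound for \<open>T\<close>.\<close>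
  have "emeasure lborel {x \<in> L. x - u \<in> K} \<le> emeasure lborel L"
    by (rule emeasure_mono) auto
  also have "\<dots> < \<infinity>" using emeasure_compact_finite[OF L(1)] .
  finally obtain e where e: "e > 0" "emeasure lborel {x \<in> L. x - u \<in> K} = ennreal e"
    using u by (cases "emeasure lborel {x \<in> L. x - u \<in> K}") auto
  obtain T where T: "open T" "K \<subseteq> T" "emeasure lebesgue (T - K) < ennreal e"
    using sets_lebesgue_outer_open[of K e] e(1) by auto
  obtain d where d: "d > 0" "(\<Union>x\<in>K. ball x d) \<subseteq> T"
    using compact_subset_open_imp_ball_epsilon_subset[OF K(1) T(1,2)] by blast
  have "\<exists>a\<in>A. a + (u + h) \<in> B" if h: "\<bar>h\<bar> < d" for h
  proof (rule ccontr)
    assume neg: "\<not> ?thesis"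
    have "{x \<in> L. x - u \<in> K} \<subseteq> (+) (- (u + h)) -` (T - K)"
    proof
      fix x assume x: "x \<in> {x \<in> L. x - u \<in> K}"
      have "x - (u + h) \<in> ball (x - u) d" using h by (simp add: dist_real_def)
      then have "x - (u + h) \<in> T" using d(2) x by blast
      moreover have "x - (u + h) \<notin> K"
      proof
        assume "x - (u + h) \<in> K"
        then have "x - (u + h) \<in> A" "x - (u + h) + (u + h) \<in> B" using x K L by auto
        with neg show False by blast
      qed
      ultimately show "x \<in> (+) (- (u + h)) -` (T - K)" by (simp add: algebra_simps)
    qed
    moreover have TK: "T - K \<in> sets borel" using T(1) by measurable
    moreover have "(+) (- (u + h)) -` (T - K) \<in> sets lborel"
      using measurable_sets[of "(+) (- (u + h))" lborel borel "T - K"] TK by simp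
    ultimately have "ennreal e \<le> emeasure lborel (T - K)"
      unfolding e(2)[symmetric] emeasure_lborel_vimage_plus[OF TK, of "- (u + h)", symmetric]
      by (intro emeasure_mono)
    with T(3) TK show False by simp
  qed
  from this[of "w - u" for w] have "\<forall>w\<in>ball u d. \<exists>a\<in>A. a + w \<in> B"
    by (simp add: dist_real_def abs_minus_commute)
  moreover have "open (ball u d)" "ball u d \<noteq> {}" using d(1) by auto
  ultimately show "\<exists>U. open U \<and> U \<noteq> {} \<and> (\<forall>u\<in>U. \<exists>a\<in>A. a + u \<in> B)" by blast
qed

section \<open>Baire category\<close>

lemma nowhere_dense_subset: "nowhere_dense T \<Longrightarrow> S \<subseteq> T \<Longrightarrow> nowhere_dense S"
  unfolding nowhere_dense_def by (metis closure_mono interior_mono subset_empty)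

lemma meagre_UN_nowhere_dense: "(\<And>n::nat. nowhere_dense (N n)) \<Longrightarrow> meagre (\<Union>n. N n)"
  unfolding meagre_def by blast

lemma meagre_subset:
  assumes "meagre T" "S \<subseteq> T"
  shows "meagre S"
proof -
  obtain N where N: "\<And>n::nat. nowhere_dense (N n)" "T = (\<Union>n. N n)"
    using assms(1) by (auto simp: meagre_def)
  have "meagre (\<Union>n. N n \<inter> S)"
    by (intro meagre_UN_nowhere_dense nowhere_dense_subset[OF N(1)]) auto
  moreover have "(\<Union>n. N n \<inter> S) = S" using N(2) assms(2) by blast
  ultimately show ?thesis by simp
qed

lemma meagre_UN:
  fixes S :: "nat \<Rightarrow> 'a::topological_space set"
  assumes "\<And>n. meagre (S n)"
  shows "meagre (\<Union>n. S n)"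
proof -
  obtain N where N: "\<And>n m::nat. nowhere_dense (N n m)" "\<And>n. S n = (\<Union>m. N n m)"
    using assms unfolding meagre_def by metis
  have "(\<Union>n. S n) = (\<Union>k. N (fst (prod_decode k)) (snd (prod_decode k)))"
    unfolding N(2) by (auto, metis fst_conv snd_conv prod_encode_inverse)
  moreover have "meagre \<dots>" by (rule meagre_UN_nowhere_dense) (rule N(1))
  ultimately show ?thesis by simp
qed

lemma nowhere_dense_imp_meagre: "nowhere_dense S \<Longrightarrow> meagre S"
  using meagre_UN_nowhere_dense[of "\<lambda>_. S"] by simp

lemma meagre_empty: "meagre {}"
  by (rule nowhere_dense_imp_meagre) (simp add: nowhere_dense_def)

lemma meagre_Un:
  assumes "meagre S" "meagre T"
  shows "meagre (S \<union> T)"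
proof -
  have "meagre (\<Union>n::nat. if n = 0 then S else T)"
    using assms by (intro meagre_UN) auto
  then show ?thesis by (rule meagre_subset) (auto split: if_splits)
qed

section \<open>The sigma-algebra of sets with the Baire property\<close>

lemma open_imp_has_Baire_property: "open U \<Longrightarrow> has_Baire_property U"
  unfolding has_Baire_property_def by (rule exI[of _ U]) (simp add: meagre_empty)

lemma meagre_imp_has_Baire_property: "meagre S \<Longrightarrow> has_Baire_property S"
  unfolding has_Baire_property_def by (rule exI[of _ "{}"]) simp

text \<open>The open set approximating the complement is \<open>interior (- U)\<close>: it differs
  from the closed set \<open>- U\<close> by a closed set with empty interior, which is nowhere
  dense.\<close>

lemma has_Baire_property_Compl:
  assumes "has_Baire_property S"
  shows "has_Baire_property (- S)"
proof -
  obtain U where U: "open U" "meagre (sym_diff S U)"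
    using assms by (auto simp: has_Baire_property_def)
  have "interior (- U - interior (- U)) \<subseteq> interior (- U)"
    by (intro interior_mono) auto
  moreover have "interior (- U - interior (- U)) \<subseteq> - U - interior (- U)"
    by (rule interior_subset)
  moreover have "closed (- U - interior (- U))"
    using U(1) by (intro closed_Diff) auto
  ultimately have "nowhere_dense (- U - interior (- U))"
    by (auto simp: nowhere_dense_def)
  then have "meagre (sym_diff S U \<union> (- U - interior (- U)))"
    by (intro meagre_Un U nowhere_dense_imp_meagre)
  then have "meagre (sym_diff (- S) (interior (- U)))"
    by (rule meagre_subset) (use interior_subset in auto)
  then show ?thesis unfolding has_Baire_property_def by blast
qed

lemma has_Baire_property_UN:
  fixes S :: "nat \<Rightarrow> 'a::topological_space set"
  assumes "\<And>n. has_Baire_property (S n)"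
  shows "has_Baire_property (\<Union>n. S n)"
proof -
  obtain U where U: "\<And>n. open (U n)" "\<And>n. meagre (sym_diff (S n) (U n))"
    using assms unfolding has_Baire_property_def by metis
  have "meagre (\<Union>n. sym_diff (S n) (U n))"
    by (rule meagre_UN) (rule U)
  then have "meagre (sym_diff (\<Union>n. S n) (\<Union>n. U n))"
    by (rule meagre_subset) auto
  then show ?thesis unfolding has_Baire_property_def using U(1) by blast
qed

lemma sigma_algebra_has_Baire_property: "sigma_algebra UNIV {S. has_Baire_property S}"
proof (rule sigma_algebra_iff2[THEN iffD2], intro conjI ballI allI impI)
  show "{} \<in> {S. has_Baire_property S}" by (simp add: open_imp_has_Baire_property)
qed (auto simp: has_Baire_property_Compl intro: has_Baire_property_UN simp flip: Compl_eq_Diff_UNIV)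

text \<open>The value \<open>\<infinity>\<close> on nonmeagre sets is what permits additivity: with
  a finite value such as 1, two disjoint nonmeagre sets would violate it. "Almost everywhere" then
  means on a comeagre set.\<close>

definition category_measure :: "'a::topological_space measure" where
  "category_measure = measure_of UNIV {S. has_Baire_property S} (\<lambda>S. if meagre S then 0 else \<infinity>)"

lemma space_category_measure: "space category_measure = UNIV"
  by (simp add: category_measure_def space_measure_of)

lemma sets_category_measure: "sets category_measure = {S. has_Baire_property S}"
  unfolding category_measure_def
  by (rule sigma_algebra.sets_measure_of_eq[OF sigma_algebra_has_Baire_property])

text \<open>For additivity, either all sets are meagre, and so is their union, or one of them is
  not, and then both sides are infinite.\<close>

lemma emeasure_category_measure:
  assumes "has_Baire_property S"
  shows "emeasure category_measure S = (if meagre S then 0 else \<infinity>)"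
proof -
  define \<mu> :: "'a set \<Rightarrow> ennreal" where "\<mu> = (\<lambda>S. if meagre S then 0 else \<infinity>)"
  have "countably_additive {S. has_Baire_property S} \<mu>"
  proof (rule countably_additiveI)
    fix A :: "nat \<Rightarrow> 'a set"
    show "(\<Sum>n. \<mu> (A n)) = \<mu> (\<Union>n. A n)"
    proof (cases "\<forall>n. meagre (A n)")
      case True
      then show ?thesis by (simp add: meagre_UN \<mu>_def)
    next
      case False
      then obtain n where n: "\<not> meagre (A n)" by blast
      then have "\<not> meagre (\<Union>n. A n)" using meagre_subset[of "\<Union>n. A n" "A n"] by blast
      moreover have "(\<Sum>n. \<mu> (A n)) = \<infinity>"
        using sum_le_suminf[of "\<lambda>n. \<mu> (A n)" "{n}"] n by (simp add: \<mu>_def top_unique)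
      ultimately show ?thesis by (simp add: \<mu>_def)
    qed
  qed
  moreover have "positive {S. has_Baire_property S} \<mu>"
    by (simp add: positive_def \<mu>_def meagre_empty)
  ultimately have "emeasure (measure_of UNIV {S. has_Baire_property S} \<mu>) S = \<mu> S"
    using assms by (intro emeasure_measure_of_sigma sigma_algebra_has_Baire_property) auto
  then show ?thesis unfolding category_measure_def \<mu>_def .
qed

lemma null_sets_category_measure: "null_sets category_measure = {S. meagre S}"
  by (auto simp: null_sets_def sets_category_measure emeasure_category_measure
      meagre_imp_has_Baire_property split: if_splits)

section \<open>The Steinhaus property for Baire category\<close>

lemma meagre_translation:
  fixes S :: "'a::real_normed_vector set"
  assumes "meagre S"
  shows "meagre ((+) a ` S)"
proof -
  obtain N where N: "\<And>n::nat. nowhere_dense (N n)" "S = (\<Union>n. N n)"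
    using assms by (auto simp: meagre_def)
  have "nowhere_dense ((+) a ` N n)" for n
    using N(1) by (simp add: nowhere_dense_def closure_translation interior_translation)
  then show ?thesis by (simp add: N(2) image_UN meagre_UN_nowhere_dense)
qed

text \<open>By the Baire category theorem the complements of the closures of countably many nowhere
  dense sets have dense intersection, which therefore meets \<open>U\<close>.\<close>

lemma not_meagre_if_open:
  fixes U :: "'a::{real_normed_vector,heine_borel} set"
  assumes "open U" "U \<noteq> {}"
  shows "\<not> meagre U"
proof
  assume "meagre U"
  then obtain N where N: "\<And>n::nat. nowhere_dense (N n)" "U = (\<Union>n. N n)"
    by (auto simp: meagre_def)
  have "UNIV \<subseteq> closure (\<Inter>(range (\<lambda>n. - closure (N n))))"
    using N(1) by (intro Baire) (auto simp: nowhere_dense_def closure_complement)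
  then have "U \<inter> (\<Inter>n. - closure (N n)) \<noteq> {}"
    using open_Int_closure_eq_empty[OF assms(1)] assms(2) by blast
  then show False using N(2) closure_subset by blast
qed

text \<open>Up to meagre sets, \<open>A\<close> and \<open>B\<close> contain nonempty open sets
  \<open>U\<close> and \<open>V\<close>. If \<open>w\<close> moves a point \<open>x\<close> of
  \<open>U\<close> into \<open>V\<close>, then \<open>U\<close> and \<open>V\<close> shifted by
  \<open>- w\<close> meet in a nonempty open set. This is not covered by the meagre sets that
  \<open>A\<close> and the shifted \<open>B\<close> miss, so some point of \<open>A\<close> is moved
  into \<open>B\<close> by \<open>w\<close>.\<close>

theorem steinhaus_measure_category_measure: "steinhaus_measure category_measure"
proof
  have "{S. open S} \<subseteq> sets (category_measure :: real measure)"
    by (auto simp: sets_category_measure open_imp_has_Baire_property)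
  from sets.sigma_sets_subset[OF this]
  show "sets borel \<subseteq> sets (category_measure :: real measure)"
    by (simp add: borel_def space_category_measure)
next
  fix A B :: "real set"
  have *: "\<exists>U. open U \<and> U \<noteq> {} \<and> meagre (U - S)"
    if S: "S \<in> sets category_measure" "S \<notin> null_sets category_measure" for S :: "real set"
  proof -
    obtain U where U: "open U" "meagre (sym_diff S U)"
      using S(1) by (auto simp: sets_category_measure has_Baire_property_def)
    have "U \<noteq> {}" using S(2) U(2) by (auto simp: null_sets_category_measure)
    moreover have "meagre (U - S)" using U(2) by (rule meagre_subset) auto
    ultimately show ?thesis using U(1) by blast
  qed
  assume "A \<in> sets category_measure" "A \<notin> null_sets category_measure"
  then obtain U where U: "open U" "U \<noteq> {}" "meagre (U - A)" using * by blast
  assume "B \<in> sets category_measure" "B \<notin> null_sets category_measure"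
  then obtain V where V: "open V" "V \<noteq> {}" "meagre (V - B)" using * by blast
  obtain x where x: "x \<in> U" using U(2) by blast
  have "\<exists>a\<in>A. a + w \<in> B" if w: "w \<in> (+) (- x) ` V" for w
  proof (rule ccontr)
    assume "\<not> ?thesis"
    then have "U \<inter> (+) (- w) ` V \<subseteq> (U - A) \<union> (+) (- w) ` (V - B)"
      by (auto simp: add.commute)
    moreover have "meagre ((U - A) \<union> (+) (- w) ` (V - B))"
      by (intro meagre_Un meagre_translation U V)
    ultimately have "meagre (U \<inter> (+) (- w) ` V)" by (rule meagre_subset[rotated])
    moreover have "open (U \<inter> (+) (- w) ` V)" using U(1) V(1) open_translation by blast
    moreover have "x \<in> U \<inter> (+) (- w) ` V" using x w by auto
    ultimately show False using not_meagre_if_open by blast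
  qed
  then show "\<exists>U. open U \<and> U \<noteq> {} \<and> (\<forall>u\<in>U. \<exists>a\<in>A. a + u \<in> B)"
    using V(1,2) open_translation[OF V(1), of "- x"] by blast
qed

theorem theorem4p1:
  fixes f :: "real \<Rightarrow> real" and C :: "real set"
  assumes "C \<subseteq> {0<..}"
    and "uncountable C"
    and "vertically_rigid_via_translations f C"
  shows "(f \<in> borel_measurable lebesgue \<longrightarrow>
            (\<exists>a b k :: real. AE x in lebesgue. f x = a + b * exp (k * x))) \<and>
         (Baire_measurable f \<longrightarrow>
            (\<exists>a b k :: real. \<exists>S. comeagre S \<and> (\<forall>x\<in>S. f x = a + b * exp (k * x))))"
proof (intro conjI impI)
  assume "f \<in> borel_measurable lebesgue"
  then show "\<exists>a b k. AE x in lebesgue. f x = a + b * exp (k * x)"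
    using steinhaus_measure_lebesgue assms by (intro steinhaus_measure.AE_exponential_if_rigid)
next
  assume "Baire_measurable f"
  then have "f \<in> borel_measurable category_measure"
    by (intro borel_measurableI)
      (simp add: Baire_measurable_def sets_category_measure space_category_measure)
  from steinhaus_measure.AE_exponential_if_rigid[OF steinhaus_measure_category_measure this assms]
  obtain a b k where "AE x in category_measure. f x = a + b * exp (k * x)"
    by blast
  \<comment> \<open>The exceptional set is replaced by a null, hence meagre, set \<open>N\<close>
    containing it; the comeagre set sought is \<open>- N\<close>.\<close>
  then obtain N where "N \<in> null_sets category_measure" "{x. f x \<noteq> a + b * exp (k * x)} \<subseteq> N"
    by (auto simp: eventually_ae_filter space_category_measure)
  then have "comeagre (- N) \<and> (\<forall>x\<in>- N. f x = a + b * exp (k * x))"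
    by (auto simp: comeagre_def null_sets_category_measure)
  then show "\<exists>a b k. \<exists>S. comeagre S \<and> (\<forall>x\<in>S. f x = a + b * exp (k * x))"
    by blast
qed

end
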